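(* Let $T$ be a tree (with at least one vertex), let $\ell$ be an integer with $0\le \ell\le |V(T)|$, and let $B=\{v\in V(T): \deg(v)\le \ell\}$. Then $$Z^+_{(\ell)}(T) = \begin{cases} 1 & \text{if } \ell=0,\\ |B| & \text{if } \ell\ge 1.\end{cases}$$
   Context: All graphs are finite, simple and undirected. Positive semidefinite (psd) color change rule: given the current set $B$ of blue vertices of a graph $G$, let $W_1,\dots,W_k$ be the vertex sets of the connected components of $G-B$. If $u\in B$ and $w\in W_i$ is the only non-blue neighbor of $u$ in the induced subgraph $G[W_i\cup B]$, then $u$ may force $w$ (written $u\to w$), and $w$ becomes blue. The rule is applied iteratively, with the components recomputed from the current blue set. A leak is a vertex that is not allowed to perform any force. For $0\le \ell\le |V(G)|$, a set $B\subseteq V(G)$ is an $\ell$-leaky positive semidefinite forcing set of $G$ if, for every choice of $\ell$ vertices as leaks (chosen after $B$ is fixed; leaks may be inside or outside $B$), starting with exactly $B$ blue, iterated application of the psd color change rule, with forces performed only by non-leak vertices, colors all of $V(G)$ blue. The $\ell$-leaky positive semidefinite forcing number $Z^+_{(\ell)}(G)$ is the minimum cardinality of an $\ell$-leaky positive semidefinite forcing set of $G$. *)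

theory Defs
  imports "Graph_Theory.Digraph_Component"
begin

text \<open>
  A finite simple undirected graph is rendered by the locale \<open>graph\<close>: a finite symmetric digraph
  without loops and without parallel arcs. Every undirected edge is thus a pair of opposite arcs, so
  the degree of a vertex is its \<open>out_degree\<close>, and the vertex sets of the connected components are
  given by \<open>pre_digraph.sccs_verts\<close>.
\<close>

text \<open>
  The library predicate \<open>tree\<close> is unsuitable here: for it, the closed walk along an arc and back
  along the opposite arc is already a cycle. The undirected cycles are the cycles of length
  at least three. Note that \<open>connected\<close> entails that there is at least one vertex.
\<close>

definition undirected_tree :: "('a, 'b) pre_digraph \<Rightarrow> bool" where
  "undirected_tree G \<longleftrightarrow>
     graph G \<and> connected G \<and> \<not> (\<exists>p. pre_digraph.cycle G p \<and> 3 \<le> length p)"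

definition psd_force :: "('a, 'b) pre_digraph \<Rightarrow> 'a set \<Rightarrow> 'a \<Rightarrow> 'a \<Rightarrow> bool" where
  "psd_force G B u w \<longleftrightarrow>
     u \<in> B \<and>
     (\<exists>W \<in> pre_digraph.sccs_verts (G \<restriction> (verts G - B)).
        w \<in> W \<and> {x. u \<rightarrow>\<^bsub>G \<restriction> (W \<union> B)\<^esub> x \<and> x \<notin> B} = {w})"

text \<open>
  \<open>leaky_psd_reach G L B C\<close>: starting from the blue set \<open>B\<close>, finitely many forces, one at a time and
  each performed by a vertex outside the leak set \<open>L\<close>, can produce the blue set \<open>C\<close>.
\<close>

inductive leaky_psd_reach :: "('a, 'b) pre_digraph \<Rightarrow> 'a set \<Rightarrow> 'a set \<Rightarrow> 'a set \<Rightarrow> bool"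
  for G L B where
  start: "leaky_psd_reach G L B B"
| force: "leaky_psd_reach G L B C \<Longrightarrow> u \<notin> L \<Longrightarrow> psd_force G C u w \<Longrightarrow>
          leaky_psd_reach G L B (insert w C)"

definition leaky_psd_forcing_set :: "('a, 'b) pre_digraph \<Rightarrow> nat \<Rightarrow> 'a set \<Rightarrow> bool" where
  "leaky_psd_forcing_set G l B \<longleftrightarrow>
     B \<subseteq> verts G \<and> (\<forall>L. L \<subseteq> verts G \<and> card L = l \<longrightarrow> leaky_psd_reach G L B (verts G))"

definition leaky_psd_forcing_number :: "('a, 'b) pre_digraph \<Rightarrow> nat \<Rightarrow> nat" where
  "leaky_psd_forcing_number G l = (LEAST k. \<exists>B. leaky_psd_forcing_set G l B \<and> card B = k)"

lemma leaky_psd_forcing_set_verts: "leaky_psd_forcing_set G l (verts G)"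
  by (simp add: leaky_psd_forcing_set_def leaky_psd_reach.start)

end

theory Submission
  imports Defs
begin

text \<open>
  In a tree, two distinct neighbours of \<open>u\<close> are never connected in the graph without \<open>u\<close>. Hence a
  blue vertex can force any of its white neighbours, and the process gets stuck only if the blue
  endpoint of every edge between blue and white is a leak. For \<open>\<ell> = 0\<close> this never happens once there
  is a blue vertex, by connectedness. For \<open>\<ell> \<ge> 1\<close> suppose that all vertices of degree at most \<open>\<ell>\<close> are
  blue and that the process is stuck with \<open>w\<close> white. Each of the at least \<open>\<ell> + 1\<close> branches at \<open>w\<close> has
  a leaf, which is blue; walking from \<open>w\<close> towards it, the first blue vertex is a leak. As the branches
  are disjoint, there are more than \<open>\<ell>\<close> leaks. Conversely, if all neighbours of a white vertex are
  leaks, it stays white, so vertices of degree at most \<open>\<ell>\<close> belong to every leaky forcing set.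
\<close>

section \<open>Adjacency, degrees and cycles\<close>

lemma (in graph) dominates_sym: "u \<rightarrow> v \<Longrightarrow> v \<rightarrow> u"
  using sym_arcs by (auto simp: symmetric_def dest: symD)

lemma (in graph) out_degree_conv_neighbours: "out_degree G v = card {x. v \<rightarrow> x}"
proof -
  have "{x. v \<rightarrow> x} = head G ` out_arcs G v"
    by (auto simp: arcs_ends_conv out_arcs_def)
  moreover have "inj_on (head G) (out_arcs G v)"
    by (rule inj_onI) (auto simp: out_arcs_def arc_to_ends_def intro: no_multi_arcs)
  ultimately show ?thesis
    by (simp add: out_degree_def card_image)
qed

text \<open>The path from \<open>x\<close> to \<open>y\<close> inside \<open>S\<close>, closed up
  through \<open>u\<close>, is a cycle: it avoids \<open>u\<close>, and it has at least one arc
  besides the two at \<open>u\<close>.\<close>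

lemma (in graph) common_neighbour_cycle:
  assumes "u \<rightarrow> x" "u \<rightarrow> y" "x \<noteq> y"
    and "x \<rightarrow>\<^sup>*\<^bsub>G \<restriction> S\<^esub> y" "S \<subseteq> verts G" "u \<notin> S"
  shows "\<exists>p. cycle p \<and> 3 \<le> length p"
proof -
  interpret H: wf_digraph "G \<restriction> S" by (rule wellformed_induce_subgraph)
  have sub: "subgraph (G \<restriction> S) G"
    using assms(5) by (rule subgraph_induce_subgraphI)
  obtain p where p: "H.apath x p y"
    using assms(4) H.reachable_apath by blast
  then have walk: "H.awalk x p y" by (simp add: H.apath_def)
  have pG: "apath x p y"
    using p sub by (rule subgraph_apath_imp_apath)
  have "set (H.awalk_verts x p) \<subseteq> S"
    using walk by (rule H.awalkE') simp
  then have pS: "set (awalk_verts x p) \<subseteq> S"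
    by (simp add: compatible_awalk_verts[OF compatible_induce_subgraph])
  have "p \<noteq> []"
    using pG assms(3) by (auto simp: apath_Nil_iff)
  obtain a where a: "a \<in> arcs G" "tail G a = u" "head G a = x"
    using assms(1) by (auto simp: arcs_ends_conv)
  obtain b where b: "b \<in> arcs G" "tail G b = y" "head G b = u"
    using dominates_sym[OF assms(2)] by (auto simp: arcs_ends_conv)
  have "awlast x p = y"
    using awalkI_apath[OF pG] by simp
  then have "apath x (p @ [b]) u"
    using pG b pS assms(6) no_loops[OF b(1)]
    by (auto simp: apath_append_iff apath_simps)
  then have "awalk u (a # p @ [b]) u" "distinct (awalk_verts x (p @ [b]))"
    using a by (auto simp: apath_def awalk_Cons_iff arc_to_ends_def)
  then have "cycle (a # p @ [b])"
    using a unfolding cycle_def by auto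
  moreover have "3 \<le> length (a # p @ [b])"
    using \<open>p \<noteq> []\<close> by (cases p) auto
  ultimately show ?thesis by blast
qed

section \<open>Forcing along the edges of a tree\<close>

locale tree_graph = graph +
  assumes connected: "connected G"
    and acyclic: "cycle p \<Longrightarrow> length p < 3"
begin

lemma neighbours_separated:
  assumes "u \<rightarrow> x" "u \<rightarrow> y" "x \<rightarrow>\<^sup>*\<^bsub>G \<restriction> S\<^esub> y" "S \<subseteq> verts G" "u \<notin> S"
  shows "x = y"
proof (rule ccontr)
  assume "x \<noteq> y"
  then obtain p where "cycle p" "3 \<le> length p"
    using common_neighbour_cycle[OF assms(1,2) _ assms(3-5)] by blast
  then show False using acyclic[of p] by simp
qed

text \<open>A second white neighbour of \<open>u\<close> in the component of \<open>w\<close> would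
  be joined to \<open>w\<close> by a path that avoids all blue vertices, in particular
  \<open>u\<close>.\<close>

lemma psd_force_neighbour:
  assumes "C \<subseteq> verts G" "u \<in> C" "w \<notin> C" "u \<rightarrow> w"
  shows "psd_force G C u w"
proof -
  let ?H = "G \<restriction> (verts G - C)"
  interpret H: wf_digraph ?H by (rule wellformed_induce_subgraph)
  let ?W = "H.scc_of w"
  have w: "w \<in> verts ?H" using assms by auto
  then have "?W \<in> H.sccs_verts" by (rule H.scc_of_in_sccs_verts)
  moreover have "w \<in> ?W" using w by (simp add: H.scc_of_def)
  moreover have "{x. u \<rightarrow>\<^bsub>G \<restriction> (?W \<union> C)\<^esub> x \<and> x \<notin> C} = {w}"
  proof (rule set_eqI, rule iffI)
    fix x assume "x \<in> {x. u \<rightarrow>\<^bsub>G \<restriction> (?W \<union> C)\<^esub> x \<and> x \<notin> C}"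
    then have "u \<rightarrow> x" "x \<in> ?W"
      by (auto simp: arcs_ends_conv)
    then have "w = x"
      using assms by (intro neighbours_separated[of u w x "verts G - C"]) (auto simp: H.scc_of_def)
    then show "x \<in> {w}" by simp
  next
    fix x assume "x \<in> {w}"
    then show "x \<in> {x. u \<rightarrow>\<^bsub>G \<restriction> (?W \<union> C)\<^esub> x \<and> x \<notin> C}"
      using assms \<open>w \<in> ?W\<close> by (auto simp: arcs_ends_conv)
  qed
  ultimately show ?thesis
    using assms(2) unfolding psd_force_def by blast
qed

text \<open>Each crossing edge with a non-leak blue end permits a force, so it is enough to exclude
  stuck sets; the number of white vertices drops at every step.\<close>

lemma leaky_psd_reach_verts:
  assumes "B \<subseteq> verts G"
    and step: "\<And>C. B \<subseteq> C \<Longrightarrow> C \<subset> verts G \<Longrightarrow> \<exists>u\<in>C - L. \<exists>w\<in>verts G - C. u \<rightarrow> w"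
  shows "leaky_psd_reach G L B (verts G)"
proof -
  have "leaky_psd_reach G L B (verts G)"
    if "leaky_psd_reach G L B C" "B \<subseteq> C" "C \<subseteq> verts G" for C
    using that
  proof (induction "card (verts G - C)" arbitrary: C rule: less_induct)
    case less
    show ?case
    proof (cases "C = verts G")
      case True
      then show ?thesis using less.prems by simp
    next
      case False
      then obtain u w where uw: "u \<in> C" "u \<notin> L" "w \<in> verts G" "w \<notin> C" "u \<rightarrow> w"
        using step less.prems by blast
      have "leaky_psd_reach G L B (insert w C)"
        using less.prems uw by (blast intro: leaky_psd_reach.force psd_force_neighbour)
      moreover have "card (verts G - insert w C) < card (verts G - C)"
        using uw by (intro psubset_card_mono) auto
      ultimately show ?thesis
        using less uw by blast
    qed
  qed
  then show ?thesis
    using assms(1) leaky_psd_reach.start by blast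
qed

section \<open>Branches at a vertex\<close>

text \<open>For a neighbour \<open>x\<close> of \<open>w\<close>, this is the component of the tree
  without \<open>w\<close> that contains \<open>x\<close>.\<close>

definition branch :: "'a \<Rightarrow> 'a \<Rightarrow> 'a set" where
  "branch w x = {z. x \<rightarrow>\<^sup>*\<^bsub>G \<restriction> (verts G - {w})\<^esub> z}"

lemma branch_subset: "branch w x \<subseteq> verts G - {w}"
  using wf_digraph.reachable_in_verts[OF wellformed_induce_subgraph]
  by (fastforce simp: branch_def)

lemma self_in_branch: "w \<rightarrow> x \<Longrightarrow> x \<in> branch w x"
proof -
  interpret H: wf_digraph "G \<restriction> (verts G - {w})" by (rule wellformed_induce_subgraph)
  assume "w \<rightarrow> x"
  then have "x \<in> verts G" "x \<noteq> w"
    by (auto simp: arcs_ends_conv dest: no_loops)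
  then show ?thesis by (simp add: branch_def)
qed

lemma branches_disjoint:
  assumes "w \<rightarrow> x" "w \<rightarrow> y" "z \<in> branch w x" "z \<in> branch w y"
  shows "x = y"
proof -
  let ?H = "G \<restriction> (verts G - {w})"
  interpret H: wf_digraph ?H by (rule wellformed_induce_subgraph)
  \<comment> \<open>Symmetry survives the deletion of \<open>w\<close>, so the walk from
    \<open>y\<close> to \<open>z\<close> can be reversed and appended to the one from
    \<open>x\<close> to \<open>z\<close>.\<close>
  have "symmetric ?H"
    by (rule induced_graph_imp_symmetric[OF sym_arcs induced_induce]) simp
  then interpret H: sym_digraph ?H by unfold_locales
  have "x \<rightarrow>\<^sup>*\<^bsub>?H\<^esub> y"
    using assms(3,4) H.symmetric_reachable'[of y z] H.reachable_trans[of x z y]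
    by (simp add: branch_def)
  then show ?thesis
    using assms(1,2) by (intro neighbours_separated[of w x y "verts G - {w}"]) auto
qed

text \<open>A walk from \<open>y\<close> that avoids \<open>x\<close> never meets \<open>w\<close>,
  which lies in a different branch at \<open>x\<close>; so it survives the deletion of
  \<open>w\<close>. The vertex \<open>x\<close> itself makes the inclusion strict.\<close>

lemma subbranch_psubset:
  assumes "w \<rightarrow> x" "x \<rightarrow> y" "y \<noteq> w"
  shows "branch x y \<subset> branch w x"
proof -
  let ?H = "G \<restriction> (verts G - {w})" and ?K = "G \<restriction> (verts G - {x})"
  interpret H: wf_digraph ?H by (rule wellformed_induce_subgraph)
  interpret K: wf_digraph ?K by (rule wellformed_induce_subgraph)
  have xw: "x \<rightarrow> w" using assms(1) by (rule dominates_sym)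
  have "w \<notin> branch x y"
    using branches_disjoint[OF xw assms(2) self_in_branch[OF xw]] assms(3) by auto
  have "z \<in> branch w x" if "y \<rightarrow>\<^sup>*\<^bsub>?K\<^esub> z" for z
    using that
  proof (induction rule: K.reachable_induct)
    case base
    have "x \<rightarrow>\<^bsub>?H\<^esub> y"
      using assms no_loops self_in_branch[OF assms(1)] by (fastforce simp: arcs_ends_conv)
    then show ?case by (simp add: branch_def H.reachable_adjI)
  next
    case (step z z')
    then have "z \<in> branch x y" "z' \<in> branch x y"
      by (auto simp: branch_def intro: K.reachable_adj_trans)
    then have "z \<noteq> w" "z' \<noteq> w" using \<open>w \<notin> branch x y\<close> by auto
    then have "z \<rightarrow>\<^bsub>?H\<^esub> z'"
      using step.hyps by (auto simp: arcs_ends_conv)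
    then show ?case
      using step.IH by (auto simp: branch_def intro: H.reachable_adj_trans)
  qed
  then have "branch x y \<subseteq> branch w x"
    by (auto simp: branch_def)
  moreover have "x \<notin> branch x y" using branch_subset by blast
  ultimately show ?thesis
    using self_in_branch[OF assms(1)] by blast
qed

text \<open>Walk away from \<open>w\<close> without turning back: a white vertex always has a
  further neighbour, but the branch ahead shrinks. So the walk meets a blue vertex right after a
  white one, and that vertex is a leak.\<close>

lemma leak_in_branch:
  assumes deg: "\<And>v. v \<in> verts G - C \<Longrightarrow> 2 \<le> out_degree G v"
    and stuck: "\<And>u v. u \<in> C \<Longrightarrow> v \<in> verts G - C \<Longrightarrow> u \<rightarrow> v \<Longrightarrow> u \<in> L"
  shows "w \<in> verts G - C \<Longrightarrow> w \<rightarrow> x \<Longrightarrow> \<exists>z\<in>L. z \<in> branch w x"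
proof (induction "card (branch w x)" arbitrary: w x rule: less_induct)
  case less
  show ?case
  proof (cases "x \<in> C")
    case True
    then show ?thesis
      using less.prems stuck dominates_sym self_in_branch by blast
  next
    case False
    have x: "x \<in> verts G - C"
      using less.prems False by (auto simp: arcs_ends_conv)
    then have "2 \<le> card {y. x \<rightarrow> y}"
      using deg by (simp add: out_degree_conv_neighbours)
    then have "\<not> {y. x \<rightarrow> y} \<subseteq> {w}"
      using card_mono[of "{w}" "{y. x \<rightarrow> y}"] by auto
    then obtain y where y: "x \<rightarrow> y" "y \<noteq> w" by auto
    then have sub: "branch x y \<subset> branch w x"
      using less.prems by (intro subbranch_psubset)
    moreover have "finite (branch w x)"
      using branch_subset finite_verts by (meson finite_Diff finite_subset)
    ultimately have "card (branch x y) < card (branch w x)"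
      by (simp add: psubset_card_mono)
    then show ?thesis
      using less.hyps[OF _ x y(1)] sub by blast
  qed
qed

section \<open>Upper bounds\<close>

lemma leaky_psd_forcing_set_low_degree:
  assumes "1 \<le> l"
  shows "leaky_psd_forcing_set G l {v \<in> verts G. out_degree G v \<le> l}"
    (is "leaky_psd_forcing_set G l ?B")
  unfolding leaky_psd_forcing_set_def
proof (intro conjI allI impI)
  fix L assume L: "L \<subseteq> verts G \<and> card L = l"
  then have "finite L" using finite_subset finite_verts by blast
  show "leaky_psd_reach G L ?B (verts G)"
  proof (rule leaky_psd_reach_verts, simp, rule ccontr)
    fix C assume C: "?B \<subseteq> C" "C \<subset> verts G"
      and "\<not> (\<exists>u\<in>C - L. \<exists>w\<in>verts G - C. u \<rightarrow> w)"
    then have stuck: "\<And>u v. u \<in> C \<Longrightarrow> v \<in> verts G - C \<Longrightarrow> u \<rightarrow> v \<Longrightarrow> u \<in> L"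
      by blast
    have deg: "l < out_degree G v" if "v \<in> verts G - C" for v
      using that C by force
    obtain w where w: "w \<in> verts G - C" using C by blast
    have "\<exists>z\<in>L. z \<in> branch w x" if "w \<rightarrow> x" for x
      \<comment> \<open>Here \<open>1 \<le> l\<close> enters: degree above \<open>l\<close> means
        degree at least 2.\<close>
      using assms deg that w stuck by (intro leak_in_branch[of C L]) force+
    then obtain f where f: "\<And>x. w \<rightarrow> x \<Longrightarrow> f x \<in> L \<and> f x \<in> branch w x"
      by metis
    \<comment> \<open>Since branches at \<open>w\<close> are disjoint, the chosen leaks are
      distinct, one for each neighbour.\<close>
    have "inj_on f {x. w \<rightarrow> x}"
      by (rule inj_onI) (metis f branches_disjoint mem_Collect_eq)
    then have "card {x. w \<rightarrow> x} \<le> card L"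
      using f \<open>finite L\<close> by (intro card_inj_on_le) auto
    then show False
      using deg[OF w] L by (simp add: out_degree_conv_neighbours)
  qed
qed auto

lemma leaky_psd_forcing_set_singleton:
  assumes "v \<in> verts G"
  shows "leaky_psd_forcing_set G 0 {v}"
  unfolding leaky_psd_forcing_set_def
proof (intro conjI allI impI)
  fix L assume "L \<subseteq> verts G \<and> card L = 0"
  then have "L = {}" using finite_subset[of L "verts G"] by auto
  show "leaky_psd_reach G L {v} (verts G)"
  proof (rule leaky_psd_reach_verts)
    fix C assume C: "{v} \<subseteq> C" "C \<subset> verts G"
    then obtain w where w: "w \<in> verts G" "w \<notin> C" by blast
    have "v \<rightarrow>\<^sup>* w"
      using symmetric_connected_imp_strongly_connected[OF sym_arcs connected] assms w by auto
    \<comment> \<open>Follow the walk from the blue \<open>v\<close>: it stays in \<open>C\<close>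
      unless some arc leaves \<open>C\<close>, and it must leave since \<open>w\<close> is
      white.\<close>
    then have "w \<in> C \<or> (\<exists>u\<in>C. \<exists>w\<in>verts G - C. u \<rightarrow> w)"
    proof (induction rule: reachable_induct)
      case base
      then show ?case using C by simp
    next
      case (step x y)
      then have "y \<in> verts G" by (auto simp: arcs_ends_conv)
      then show ?case using step by blast
    qed
    then show "\<exists>u\<in>C - L. \<exists>w\<in>verts G - C. u \<rightarrow> w"
      using w \<open>L = {}\<close> by auto
  qed (use assms in auto)
qed (use assms in auto)

end

section \<open>Lower bounds\<close>

lemma leaky_psd_reach_mono: "leaky_psd_reach G L B C \<Longrightarrow> B \<subseteq> C"
  by (induction rule: leaky_psd_reach.induct) auto

lemma psd_force_dominates: "psd_force G B u w \<Longrightarrow> u \<rightarrow>\<^bsub>G\<^esub> w"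
  unfolding psd_force_def by (auto dest: dominates_induce_subgraphD)

lemma leaky_psd_reach_leaky_neighbours:
  assumes "leaky_psd_reach G L B C" "v \<notin> B" "\<And>u. u \<rightarrow>\<^bsub>G\<^esub> v \<Longrightarrow> u \<in> L"
  shows "v \<notin> C"
  using assms
  by (induction rule: leaky_psd_reach.induct) (auto dest: psd_force_dominates)

lemma (in graph) low_degree_in_leaky_psd_forcing_set:
  assumes "leaky_psd_forcing_set G l S" "l \<le> card (verts G)"
    and "v \<in> verts G" "out_degree G v \<le> l"
  shows "v \<in> S"
proof (rule ccontr)
  assume "v \<notin> S"
  have N: "{x. v \<rightarrow> x} \<subseteq> verts G" by (auto simp: arcs_ends_conv)
  have "card {x. v \<rightarrow> x} \<le> l"
    using assms(4) by (simp add: out_degree_conv_neighbours)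
  \<comment> \<open>The neighbours of \<open>v\<close> are padded to exactly \<open>l\<close> leaks;
    \<open>l \<le> card (verts G)\<close> leaves room for this.\<close>
  then obtain L where L: "{x. v \<rightarrow> x} \<subseteq> L" "L \<subseteq> verts G" "card L = l"
    using exists_subset_between[OF _ assms(2) N finite_verts] by blast
  then have "leaky_psd_reach G L S (verts G)"
    using assms(1) by (simp add: leaky_psd_forcing_set_def)
  then have "v \<notin> verts G"
    using \<open>v \<notin> S\<close> L(1) dominates_sym by (elim leaky_psd_reach_leaky_neighbours) auto
  then show False using assms(3) by simp
qed

lemma leaky_psd_reach_empty: "leaky_psd_reach G L {} C \<Longrightarrow> C = {}"
  by (induction rule: leaky_psd_reach.induct) (auto simp: psd_force_def)

text \<open>The bound on \<open>l\<close> provides at least one leak set, so the forcing condition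
  is not vacuous; from the empty set no force can start.\<close>

lemma leaky_psd_forcing_set_nonempty:
  assumes "leaky_psd_forcing_set G l S" "l \<le> card (verts G)" "verts G \<noteq> {}"
  shows "S \<noteq> {}"
proof
  assume "S = {}"
  obtain L where "L \<subseteq> verts G" "card L = l"
    using assms(2) obtain_subset_with_card_n by metis
  then have "leaky_psd_reach G L {} (verts G)"
    using assms(1) \<open>S = {}\<close> by (simp add: leaky_psd_forcing_set_def)
  then show False using leaky_psd_reach_empty assms(3) by metis
qed

lemma leaky_psd_forcing_number_eqI:
  assumes "leaky_psd_forcing_set G l B"
    and "\<And>S. leaky_psd_forcing_set G l S \<Longrightarrow> card B \<le> card S"
  shows "leaky_psd_forcing_number G l = card B"
  unfolding leaky_psd_forcing_number_def using assms by (intro Least_equality) auto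

theorem theorem25:
  fixes T :: "('a, 'b) pre_digraph" and l :: nat and B :: "'a set"
  assumes "undirected_tree T"
    and "l \<le> card (verts T)"
    and "B = {v \<in> verts T. out_degree T v \<le> l}"
  shows "leaky_psd_forcing_number T l = (if l = 0 then 1 else card B)"
proof -
  interpret graph T using assms(1) by (simp add: undirected_tree_def)
  interpret tree_graph T
    using assms(1) by unfold_locales (auto simp: undirected_tree_def not_le[symmetric])
  \<comment> \<open>An infinite set would have \<open>card\<close> 0, so both lower bounds on
    \<open>card S\<close> rely on finiteness.\<close>
  have finite_S: "finite S" if "leaky_psd_forcing_set T l S" for S
    using that finite_subset[OF _ finite_verts] by (auto simp: leaky_psd_forcing_set_def)
  show ?thesis
  proof (cases "l = 0")
    case True
    obtain v where v: "v \<in> verts T"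
      using connected by (auto simp: connected_conv)
    have "leaky_psd_forcing_number T l = card {v}"
    proof (rule leaky_psd_forcing_number_eqI)
      show "leaky_psd_forcing_set T l {v}"
        using leaky_psd_forcing_set_singleton[OF v] True by simp
      fix S assume "leaky_psd_forcing_set T l S"
      then show "card {v} \<le> card S"
        using leaky_psd_forcing_set_nonempty[OF _ assms(2)] v finite_S
        by (auto simp: Suc_le_eq card_gt_0_iff)
    qed
    then show ?thesis using True by simp
  next
    case False
    have "leaky_psd_forcing_number T l = card B"
    proof (rule leaky_psd_forcing_number_eqI)
      show "leaky_psd_forcing_set T l B"
        using leaky_psd_forcing_set_low_degree False assms(3) by simp
      fix S assume S: "leaky_psd_forcing_set T l S"
      have "B \<subseteq> S"
        using low_degree_in_leaky_psd_forcing_set[OF S assms(2)] assms(3) by blast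
      then show "card B \<le> card S"
        using finite_S[OF S] by (rule card_mono[rotated])
    qed
    then show ?thesis using False by simp
  qed
qed

end
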